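(* Let $(M,J,g,G)$ be an almost anti-Hermitian manifold, let $\nabla$ be a linear connection on $M$, and let $\nabla^{\ast}$ and $\nabla^{J}$ denote respectively its $g$-conjugate and $J$-conjugate connections. Let $R$, $R^{\ast}$, $R^{J}$ be the $(0,4)$-curvature tensor fields of $\nabla$, $\nabla^{\ast}$, $\nabla^{J}$ respectively. Then for all vector fields $X,Y,Z,W$ on $M$, $$R(X,Y,JZ,W)=-R^{\ast}(X,Y,W,JZ)=R^{J}(X,Y,Z,JW).$$
   Context: An almost anti-Hermitian manifold $(M,J,g,G)$ is a smooth $2n$-dimensional manifold $M$ with an almost complex structure $J$ ($J^{2}=-\mathrm{id}$), a pseudo-Riemannian metric $g$ of neutral signature $(n,n)$ satisfying $g(JX,JY)=-g(X,Y)$, equivalently $g(JX,Y)=g(X,JY)$, for all vector fields $X,Y$, and the twin metric $G(X,Y)=g(JX,Y)$. A linear connection is a connection on $TM$ (not assumed torsion-free). The $g$-conjugate $\nabla^{\ast}$ of $\nabla$ is the linear connection determined by $Zg(X,Y)=g(\nabla_Z X,Y)+g(X,\nabla^{\ast}_Z Y)$ for all vector fields $X,Y,Z$. The $J$-conjugate $\nabla^{J}$ is the linear connection $\nabla^{J}_X Y=J^{-1}(\nabla_X (JY))$. The curvature of a linear connection $D$ is $R^{D}(X,Y)Z=D_XD_YZ-D_YD_XZ-D_{[X,Y]}Z$, and its $(0,4)$-curvature tensor field is $R^{D}(X,Y,Z,W)=g(R^{D}(X,Y)Z,W)$ (the metric $g$ is used for all three connections). $R,R^{\ast},R^{J}$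 are these tensor fields for $D=\nabla,\nabla^{\ast},\nabla^{J}$. *)

theory Defs
  imports "HOL-Analysis.Analysis" "HOL-Library.Function_Algebras"
begin

instantiation "fun" :: (type, real_vector) real_vector
begin

definition scaleR_fun :: "real \<Rightarrow> ('a \<Rightarrow> 'b) \<Rightarrow> 'a \<Rightarrow> 'b"
  where "scaleR_fun a f = (\<lambda>x. a *\<^sub>R f x)"

instance
  by standard (simp_all add: scaleR_fun_def plus_fun_def scaleR_add_right scaleR_add_left)

end


(* C^k and C^infinity on an open subset S of a Euclidean space. *)

primrec Ck_on :: "nat \<Rightarrow> 'e::euclidean_space set \<Rightarrow> ('e \<Rightarrow> 'b::real_normed_vector) \<Rightarrow> bool" where
  "Ck_on 0 S f \<longleftrightarrow> continuous_on S f"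
| "Ck_on (Suc k) S f \<longleftrightarrow>
     (\<forall>x\<in>S. f differentiable (at x)) \<and>
     (\<forall>v. Ck_on k S (\<lambda>x. frechet_derivative f (at x) v))"

definition smooth_on :: "'e::euclidean_space set \<Rightarrow> ('e \<Rightarrow> 'b::real_normed_vector) \<Rightarrow> bool"
  where "smooth_on S f \<longleftrightarrow> (\<forall>k. Ck_on k S f)"


(* A chart is a pair (U, \<phi>) of an open domain and a coordinate map, whose values
   outside U are irrelevant. The atlas need not be maximal. The dimension of the
   manifold is DIM('e). *)

record ('a, 'e) mfd =
  mtop :: "'a topology"
  atlas :: "('a set \<times> ('a \<Rightarrow> 'e)) set"

abbreviation pts :: "('a, 'e) mfd \<Rightarrow> 'a set"
  where "pts M \<equiv> topspace (mtop M)"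

definition smooth_manifold :: "('a, 'e::euclidean_space) mfd \<Rightarrow> bool" where
  "smooth_manifold M \<longleftrightarrow>
     Hausdorff_space (mtop M) \<and> second_countable (mtop M) \<and>
     (\<forall>(U, \<phi>) \<in> atlas M. openin (mtop M) U \<and> open (\<phi> ` U) \<and>
        homeomorphic_map (subtopology (mtop M) U) (top_of_set (\<phi> ` U)) \<phi>) \<and>
     (\<Union>(U, \<phi>) \<in> atlas M. U) = pts M \<and>
     (\<forall>(U, \<phi>) \<in> atlas M. \<forall>(V, \<psi>) \<in> atlas M.
        smooth_on (\<phi> ` (U \<inter> V)) (\<psi> \<circ> inv_into U \<phi>))"

definition smooth_functions :: "('a, 'e::euclidean_space) mfd \<Rightarrow> ('a \<Rightarrow> real) set" where
  "smooth_functions M = {f. \<forall>(U, \<phi>) \<in> atlas M. smooth_on (\<phi> ` U) (f \<circ> inv_into U \<phi>)}"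


(* Tangent vectors at p are the derivations at p of the algebra of smooth functions on M.
   They are total functionals here; the value 0 off the smooth functions makes equality
   of tangent vectors coincide with equality of functionals. *)

type_synonym 'a tvec = "('a \<Rightarrow> real) \<Rightarrow> real"

definition tangent_space :: "('a, 'e::euclidean_space) mfd \<Rightarrow> 'a \<Rightarrow> 'a tvec set" where
  "tangent_space M p = {v.
     (\<forall>f \<in> smooth_functions M. \<forall>h \<in> smooth_functions M. v (f + h) = v f + v h) \<and>
     (\<forall>f \<in> smooth_functions M. \<forall>a. v (a *\<^sub>R f) = a * v f) \<and>
     (\<forall>f \<in> smooth_functions M. \<forall>h \<in> smooth_functions M. v (f * h) = f p * v h + h p * v f) \<and>
     (\<forall>f. f \<notin> smooth_functions M \<longrightarrow> v f = 0)}"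

(* Vector fields, and scalar functions built from them below, are extended by 0 outside
   the set of points, so that they are equal as soon as they agree on M. *)

type_synonym 'a vfield = "'a \<Rightarrow> 'a tvec"

definition deriv_along :: "'a vfield \<Rightarrow> ('a \<Rightarrow> real) \<Rightarrow> 'a \<Rightarrow> real"
  where "deriv_along X f = (\<lambda>p. X p f)"

definition vector_fields :: "('a, 'e::euclidean_space) mfd \<Rightarrow> 'a vfield set" where
  "vector_fields M = {X.
     (\<forall>p \<in> pts M. X p \<in> tangent_space M p) \<and>
     (\<forall>p. p \<notin> pts M \<longrightarrow> X p = 0) \<and>
     (\<forall>f \<in> smooth_functions M. deriv_along X f \<in> smooth_functions M)}"

definition fmult :: "('a \<Rightarrow> real) \<Rightarrow> 'a vfield \<Rightarrow> 'a vfield"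
  where "fmult f X = (\<lambda>p. f p *\<^sub>R X p)"

definition lie_bracket :: "'a vfield \<Rightarrow> 'a vfield \<Rightarrow> 'a vfield"
  where "lie_bracket X Y = (\<lambda>p f. X p (deriv_along Y f) - Y p (deriv_along X f))"


definition linear_between :: "'v::real_vector set \<Rightarrow> 'w::real_vector set \<Rightarrow> ('v \<Rightarrow> 'w) \<Rightarrow> bool" where
  "linear_between V W L \<longleftrightarrow>
     (\<forall>v \<in> V. L v \<in> W) \<and>
     (\<forall>v \<in> V. \<forall>w \<in> V. L (v + w) = L v + L w) \<and>
     (\<forall>v \<in> V. \<forall>a. L (a *\<^sub>R v) = a *\<^sub>R L v)"

definition symmetric_bilinear_on :: "'v::real_vector set \<Rightarrow> ('v \<Rightarrow> 'v \<Rightarrow> real) \<Rightarrow> bool" where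
  "symmetric_bilinear_on V b \<longleftrightarrow>
     (\<forall>v \<in> V. linear_between V UNIV (b v)) \<and> (\<forall>v \<in> V. \<forall>w \<in> V. b v w = b w v)"

(* Existence of an orthonormal basis with r vectors of square 1 and s of square -1;
   in particular b is nondegenerate. *)
definition has_signature_on ::
    "'v::real_vector set \<Rightarrow> ('v \<Rightarrow> 'v \<Rightarrow> real) \<Rightarrow> nat \<Rightarrow> nat \<Rightarrow> bool" where
  "has_signature_on V b r s \<longleftrightarrow>
     (\<exists>e :: nat \<Rightarrow> 'v.
        inj_on e {..<r + s} \<and> independent (e ` {..<r + s}) \<and> span (e ` {..<r + s}) = V \<and>
        (\<forall>i < r + s. \<forall>j < r + s.
           b (e i) (e j) = (if i \<noteq> j then 0 else if i < r then 1 else - 1)))"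


type_synonym 'a tform = "'a \<Rightarrow> 'a tvec \<Rightarrow> 'a tvec \<Rightarrow> real"
type_synonym 'a tendo = "'a \<Rightarrow> 'a tvec \<Rightarrow> 'a tvec"

definition on_fields ::
    "('a, 'e) mfd \<Rightarrow> 'a tform \<Rightarrow> 'a vfield \<Rightarrow> 'a vfield \<Rightarrow> 'a \<Rightarrow> real" where
  "on_fields M g X Y = (\<lambda>p. if p \<in> pts M then g p (X p) (Y p) else 0)"

definition endo_on_fields :: "('a, 'e) mfd \<Rightarrow> 'a tendo \<Rightarrow> 'a vfield \<Rightarrow> 'a vfield" where
  "endo_on_fields M J X = (\<lambda>p. if p \<in> pts M then J p (X p) else 0)"

definition tendo_inv :: "('a, 'e::euclidean_space) mfd \<Rightarrow> 'a tendo \<Rightarrow> 'a tendo" where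
  "tendo_inv M J = (\<lambda>p. inv_into (tangent_space M p) (J p))"

definition pseudo_riemannian_metric ::
    "('a, 'e::euclidean_space) mfd \<Rightarrow> nat \<Rightarrow> nat \<Rightarrow> 'a tform \<Rightarrow> bool" where
  "pseudo_riemannian_metric M r s g \<longleftrightarrow>
     (\<forall>p \<in> pts M. symmetric_bilinear_on (tangent_space M p) (g p) \<and>
        has_signature_on (tangent_space M p) (g p) r s) \<and>
     (\<forall>X \<in> vector_fields M. \<forall>Y \<in> vector_fields M. on_fields M g X Y \<in> smooth_functions M)"

definition almost_complex_structure ::
    "('a, 'e::euclidean_space) mfd \<Rightarrow> 'a tendo \<Rightarrow> bool" where
  "almost_complex_structure M J \<longleftrightarrow>
     (\<forall>p \<in> pts M. linear_between (tangent_space M p) (tangent_space M p) (J p) \<and>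
        (\<forall>v \<in> tangent_space M p. J p (J p v) = - v)) \<and>
     (\<forall>X \<in> vector_fields M. endo_on_fields M J X \<in> vector_fields M)"

definition almost_anti_hermitian ::
    "nat \<Rightarrow> ('a, 'e::euclidean_space) mfd \<Rightarrow> 'a tendo \<Rightarrow> 'a tform \<Rightarrow> 'a tform \<Rightarrow> bool" where
  "almost_anti_hermitian n M J g G \<longleftrightarrow>
     smooth_manifold M \<and> DIM('e) = 2 * n \<and>
     almost_complex_structure M J \<and>
     pseudo_riemannian_metric M n n g \<and>
     (\<forall>X \<in> vector_fields M. \<forall>Y \<in> vector_fields M.
        on_fields M g (endo_on_fields M J X) (endo_on_fields M J Y) = - on_fields M g X Y) \<and>
     (\<forall>X \<in> vector_fields M. \<forall>Y \<in> vector_fields M.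
        on_fields M G X Y = on_fields M g (endo_on_fields M J X) Y)"


(* D X Y is the covariant derivative of Y along X. Homogeneity of D X over the reals is
   the instance of the Leibniz rule for constant functions. *)

type_synonym 'a connection = "'a vfield \<Rightarrow> 'a vfield \<Rightarrow> 'a vfield"

definition linear_connection :: "('a, 'e::euclidean_space) mfd \<Rightarrow> 'a connection \<Rightarrow> bool" where
  "linear_connection M D \<longleftrightarrow>
     (\<forall>X \<in> vector_fields M. \<forall>Y \<in> vector_fields M. D X Y \<in> vector_fields M) \<and>
     (\<forall>X \<in> vector_fields M. \<forall>X' \<in> vector_fields M. \<forall>Y \<in> vector_fields M.
        D (X + X') Y = D X Y + D X' Y) \<and>
     (\<forall>f \<in> smooth_functions M. \<forall>X \<in> vector_fields M. \<forall>Y \<in> vector_fields M.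
        D (fmult f X) Y = fmult f (D X Y)) \<and>
     (\<forall>X \<in> vector_fields M. \<forall>Y \<in> vector_fields M. \<forall>Y' \<in> vector_fields M.
        D X (Y + Y') = D X Y + D X Y') \<and>
     (\<forall>f \<in> smooth_functions M. \<forall>X \<in> vector_fields M. \<forall>Y \<in> vector_fields M.
        D X (fmult f Y) = fmult (deriv_along X f) Y + fmult f (D X Y))"

definition is_g_conjugate ::
    "('a, 'e::euclidean_space) mfd \<Rightarrow> 'a tform \<Rightarrow> 'a connection \<Rightarrow> 'a connection \<Rightarrow> bool" where
  "is_g_conjugate M g D Dstar \<longleftrightarrow>
     linear_connection M Dstar \<and>
     (\<forall>X \<in> vector_fields M. \<forall>Y \<in> vector_fields M. \<forall>Z \<in> vector_fields M.
        deriv_along Z (on_fields M g X Y) =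
          on_fields M g (D Z X) Y + on_fields M g X (Dstar Z Y))"

definition J_conjugate ::
    "('a, 'e::euclidean_space) mfd \<Rightarrow> 'a tendo \<Rightarrow> 'a connection \<Rightarrow> 'a connection" where
  "J_conjugate M J D X Y = endo_on_fields M (tendo_inv M J) (D X (endo_on_fields M J Y))"

definition curvature :: "'a connection \<Rightarrow> 'a vfield \<Rightarrow> 'a vfield \<Rightarrow> 'a vfield \<Rightarrow> 'a vfield" where
  "curvature D X Y Z = D X (D Y Z) - D Y (D X Z) - D (lie_bracket X Y) Z"

definition curvature4 ::
    "('a, 'e) mfd \<Rightarrow> 'a tform \<Rightarrow> 'a connection \<Rightarrow>
     'a vfield \<Rightarrow> 'a vfield \<Rightarrow> 'a vfield \<Rightarrow> 'a vfield \<Rightarrow> 'a \<Rightarrow> real" where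
  "curvature4 M g D X Y Z W = on_fields M g (curvature D X Y Z) W"

end

theory Submission
  imports Defs
begin

text \<open>
  Both equalities are instances of simple principles about conjugation.

  Metric duality: write \<open>g(A,B)\<close> for the function obtained from two vector fields. Differentiating
  \<open>g(A,B)\<close> along \<open>Y\<close> and then along \<open>X\<close> with the defining rule of \<open>\<nabla>\<^sup>*\<close> gives
  \<open>g(\<nabla>\<^sub>X\<nabla>\<^sub>Y A, B) + g(A, \<nabla>\<^sup>*\<^sub>X\<nabla>\<^sup>*\<^sub>Y B)\<close> plus two mixed terms that are exchanged by swapping
  \<open>X\<close> and \<open>Y\<close>. Subtracting the swapped identity and the derivative along \<open>[X,Y]\<close>, the left-hand side
  vanishes by the definition of the bracket, and what remains is
  \<open>g(R(X,Y)A, B) + g(A, R\<^sup>*(X,Y)B) = 0\<close>. With \<open>A = JZ\<close> and \<open>B = W\<close> this is the first equality.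

  Gauge invariance: \<open>\<nabla>\<^sup>J\<close> is \<open>\<nabla>\<close> conjugated by the automorphism \<open>J\<close> of the tangent bundle, so its
  curvature is the conjugate \<open>J\<^sup>-\<^sup>1 R(X,Y) J\<close>. As \<open>J\<^sup>-\<^sup>1 = -J\<close> and \<open>g(JA,JB) = -g(A,B)\<close>, moving
  \<open>J\<^sup>-\<^sup>1\<close> across \<open>g\<close> turns \<open>g(J\<^sup>-\<^sup>1 R(X,Y)JZ, JW)\<close> into \<open>g(R(X,Y)JZ, W)\<close>, the second equality.

  Both arguments apply the axioms of a connection to \<open>[X,Y]\<close> and to sums of vector fields, so these
  have to be vector fields again. Since tangent vectors are derivations, that rests on one
  analytic fact: smooth functions form an algebra, by the sum and product rules for derivatives.
\<close>

section \<open>The algebra of smooth functions\<close>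

text \<open>Openness of the domain matters: there the Frechet derivatives of the two functions,
  which look at a full neighbourhood of the point, agree as well.\<close>

lemma Ck_on_cong:
  fixes f h :: "'e::euclidean_space \<Rightarrow> 'b::real_normed_vector"
  assumes "open S" "Ck_on k S f" "\<And>x. x \<in> S \<Longrightarrow> f x = h x"
  shows "Ck_on k S h"
  using assms(2,3)
proof (induction k arbitrary: f h)
  case 0
  then show ?case
    using continuous_on_cong by force
next
  case (Suc k)
  have hd: "(h has_derivative frechet_derivative f (at x)) (at x)" if "x \<in> S" for x
  proof (rule has_derivative_transform_within_open[OF _ assms(1) that Suc.prems(2)])
    show "(f has_derivative frechet_derivative f (at x)) (at x)"
      using Suc.prems(1) that by (simp add: frechet_derivative_works[symmetric])
  qed
  have "frechet_derivative f (at x) v = frechet_derivative h (at x) v" if "x \<in> S" for x v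
    using frechet_derivative_at[OF hd[OF that]] by simp
  then show ?case
    using Suc.prems(1) hd
    by (auto intro: differentiableI Suc.IH[of "\<lambda>x. frechet_derivative f (at x) _"])
qed

lemma Ck_on_SucD:
  assumes "Ck_on (Suc k) S f"
  shows "Ck_on k S f"
  using assms
proof (induction k arbitrary: f)
  case 0
  then show ?case
    by (simp add: continuous_at_imp_continuous_on differentiable_imp_continuous_within)
qed auto

lemma Ck_on_const: "Ck_on k S (\<lambda>x. c)"
  by (induction k arbitrary: c) simp_all

lemma Ck_on_add:
  assumes "open S" "Ck_on k S f" "Ck_on k S h"
  shows "Ck_on k S (\<lambda>x. f x + h x)"
  using assms(2,3)
proof (induction k arbitrary: f h)
  case 0
  then show ?case by (simp add: continuous_on_add)
next
  case (Suc k)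
  have der: "((\<lambda>x. f x + h x) has_derivative
      (\<lambda>v. frechet_derivative f (at x) v + frechet_derivative h (at x) v)) (at x)"
    if "x \<in> S" for x
    using Suc.prems that by (intro has_derivative_add) (auto simp: frechet_derivative_works[symmetric])
  have "Ck_on k S (\<lambda>x. frechet_derivative (\<lambda>x. f x + h x) (at x) v)" for v
  proof (rule Ck_on_cong[OF assms(1)])
    show "Ck_on k S (\<lambda>x. frechet_derivative f (at x) v + frechet_derivative h (at x) v)"
      using Suc by simp
    show "frechet_derivative f (at x) v + frechet_derivative h (at x) v
        = frechet_derivative (\<lambda>x. f x + h x) (at x) v" if "x \<in> S" for x
      using fun_cong[OF frechet_derivative_at[OF der[OF that]], of v] by simp
  qed
  then show ?case
    using der by (auto intro: differentiableI)
qed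

text \<open>The product rule expresses the derivative of a product through \<open>f\<close>, \<open>h\<close> and their
  derivatives, so the induction also uses that \<open>C\<^sup>k\<^sup>+\<^sup>1\<close> functions are \<open>C\<^sup>k\<close>.\<close>

lemma Ck_on_mult:
  fixes f h :: "'e::euclidean_space \<Rightarrow> 'b::real_normed_algebra"
  assumes "open S" "Ck_on k S f" "Ck_on k S h"
  shows "Ck_on k S (\<lambda>x. f x * h x)"
  using assms(2,3)
proof (induction k arbitrary: f h)
  case 0
  then show ?case by (simp add: continuous_on_mult)
next
  case (Suc k)
  have der: "((\<lambda>x. f x * h x) has_derivative
      (\<lambda>v. f x * frechet_derivative h (at x) v + frechet_derivative f (at x) v * h x)) (at x)"
    if "x \<in> S" for x
    using Suc.prems that by (intro has_derivative_mult) (auto simp: frechet_derivative_works[symmetric])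
  have "Ck_on k S (\<lambda>x. frechet_derivative (\<lambda>x. f x * h x) (at x) v)" for v
  proof (rule Ck_on_cong[OF assms(1)])
    show "Ck_on k S (\<lambda>x. f x * frechet_derivative h (at x) v + frechet_derivative f (at x) v * h x)"
      using Suc.prems Ck_on_SucD[OF Suc.prems(1)] Ck_on_SucD[OF Suc.prems(2)]
      by (intro Ck_on_add assms(1) Suc.IH) simp_all
    show "f x * frechet_derivative h (at x) v + frechet_derivative f (at x) v * h x
        = frechet_derivative (\<lambda>x. f x * h x) (at x) v" if "x \<in> S" for x
      using fun_cong[OF frechet_derivative_at[OF der[OF that]], of v] by simp
  qed
  then show ?case
    using der by (auto intro: differentiableI)
qed

lemma smooth_functions_const: "(\<lambda>p. c) \<in> smooth_functions M"
  by (auto simp: smooth_functions_def smooth_on_def comp_def Ck_on_const)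

lemma open_chart_image:
  assumes "smooth_manifold M" "(U, \<phi>) \<in> atlas M"
  shows "open (\<phi> ` U)"
  using assms by (auto simp: smooth_manifold_def)

lemma smooth_functions_add:
  assumes "smooth_manifold M" "f \<in> smooth_functions M" "h \<in> smooth_functions M"
  shows "f + h \<in> smooth_functions M"
  using assms
  by (auto simp: smooth_functions_def smooth_on_def comp_def plus_fun_def
      intro!: Ck_on_add open_chart_image)

lemma smooth_functions_mult:
  assumes "smooth_manifold M" "f \<in> smooth_functions M" "h \<in> smooth_functions M"
  shows "f * h \<in> smooth_functions M"
  using assms
  by (auto simp: smooth_functions_def smooth_on_def comp_def times_fun_def
      intro!: Ck_on_mult open_chart_image)

lemma subspace_smooth_functions:
  assumes "smooth_manifold M"
  shows "subspace (smooth_functions M)"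
proof (rule subspaceI)
  show "0 \<in> smooth_functions M"
    using smooth_functions_const[of 0 M] by (simp add: zero_fun_def)
  show "f + h \<in> smooth_functions M"
    if "f \<in> smooth_functions M" "h \<in> smooth_functions M" for f h
    using smooth_functions_add[OF assms that] .
  show "c *\<^sub>R f \<in> smooth_functions M" if "f \<in> smooth_functions M" for c f
    using smooth_functions_mult[OF assms smooth_functions_const[of c] that]
    by (simp add: times_fun_def scaleR_fun_def)
qed

section \<open>The Lie algebra of vector fields\<close>

lemma scaleR_apply: "(c *\<^sub>R f) x = c *\<^sub>R f x"
  by (simp add: scaleR_fun_def)

lemma subspace_tangent_space: "subspace (tangent_space M p)"
  by (rule subspaceI)
    (auto simp: tangent_space_def scaleR_apply ring_distribs)

lemma subspace_vector_fields:
  assumes "smooth_manifold M"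
  shows "subspace (vector_fields M)"
proof (rule subspaceI)
  note sub = subspace_smooth_functions[OF assms] subspace_tangent_space[of M]
  have eqs: "deriv_along 0 f = 0" "deriv_along (X + Y) f = deriv_along X f + deriv_along Y f"
    "deriv_along (c *\<^sub>R X) f = c *\<^sub>R deriv_along X f" for X Y :: "'a vfield" and f c
    by (simp_all add: deriv_along_def fun_eq_iff scaleR_apply)
  show "0 \<in> vector_fields M"
    using sub by (auto simp: vector_fields_def eqs subspace_0)
  show "X + Y \<in> vector_fields M" if "X \<in> vector_fields M" "Y \<in> vector_fields M" for X Y
    using that sub by (auto simp: vector_fields_def eqs subspace_add)
  show "c *\<^sub>R X \<in> vector_fields M" if "X \<in> vector_fields M" for c X
    using that sub by (auto simp: vector_fields_def eqs scaleR_apply subspace_scale)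
qed

text \<open>A vector field acts as a derivation of the algebra of smooth functions. These are identities
  of functions on the whole carrier type, because a vector field vanishes off the manifold.\<close>

lemma
  assumes "X \<in> vector_fields M"
  shows deriv_along_add: "\<lbrakk>f \<in> smooth_functions M; h \<in> smooth_functions M\<rbrakk>
          \<Longrightarrow> deriv_along X (f + h) = deriv_along X f + deriv_along X h"
    and deriv_along_scaleR: "f \<in> smooth_functions M
          \<Longrightarrow> deriv_along X (a *\<^sub>R f) = a *\<^sub>R deriv_along X f"
    and deriv_along_mult: "\<lbrakk>f \<in> smooth_functions M; h \<in> smooth_functions M\<rbrakk>
          \<Longrightarrow> deriv_along X (f * h) = f * deriv_along X h + h * deriv_along X f"
    and deriv_along_not_smooth: "f \<notin> smooth_functions M \<Longrightarrow> deriv_along X f = 0"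
proof -
  have X: "X p \<in> tangent_space M p \<or> X p = 0" for p
    using assms by (auto simp: vector_fields_def)
  show "deriv_along X (f + h) = deriv_along X f + deriv_along X h"
    if "f \<in> smooth_functions M" "h \<in> smooth_functions M" for f h
  proof
    show "deriv_along X (f + h) p = (deriv_along X f + deriv_along X h) p" for p
      using X[of p] that by (auto simp: deriv_along_def tangent_space_def)
  qed
  show "deriv_along X (a *\<^sub>R f) = a *\<^sub>R deriv_along X f" if "f \<in> smooth_functions M" for a f
  proof
    show "deriv_along X (a *\<^sub>R f) p = (a *\<^sub>R deriv_along X f) p" for p
      using X[of p] that by (auto simp: deriv_along_def tangent_space_def scaleR_apply)
  qed
  show "deriv_along X (f * h) = f * deriv_along X h + h * deriv_along X f"
    if "f \<in> smooth_functions M" "h \<in> smooth_functions M" for f h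
  proof
    show "deriv_along X (f * h) p = (f * deriv_along X h + h * deriv_along X f) p" for p
      using X[of p] that by (auto simp: deriv_along_def tangent_space_def)
  qed
  show "deriv_along X f = 0" if "f \<notin> smooth_functions M" for f
  proof
    show "deriv_along X f p = 0 p" for p
      using X[of p] that by (auto simp: deriv_along_def tangent_space_def)
  qed
qed

lemma deriv_along_smooth:
  "\<lbrakk>X \<in> vector_fields M; f \<in> smooth_functions M\<rbrakk> \<Longrightarrow> deriv_along X f \<in> smooth_functions M"
  by (simp add: vector_fields_def)

lemma deriv_along_lie_bracket:
  "deriv_along (lie_bracket X Y) f = deriv_along X (deriv_along Y f) - deriv_along Y (deriv_along X f)"
  by (simp add: deriv_along_def lie_bracket_def fun_eq_iff)

text \<open>The second-order terms \<open>(Xf)(Yh) + (Xh)(Yf)\<close> in the product rule for \<open>XY\<close> are symmetric in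
  \<open>X\<close> and \<open>Y\<close>, which is why the commutator is again a derivation.\<close>

lemma lie_bracket_in_vector_fields:
  assumes M: "smooth_manifold M" and X: "X \<in> vector_fields M" and Y: "Y \<in> vector_fields M"
  shows "lie_bracket X Y \<in> vector_fields M"
proof -
  let ?B = "lie_bracket X Y" and ?S = "smooth_functions M"
  note XY = deriv_along_smooth[OF X] deriv_along_smooth[OF Y]
  have add: "deriv_along ?B (f + h) = deriv_along ?B f + deriv_along ?B h"
    if "f \<in> ?S" "h \<in> ?S" for f h
    using that XY by (simp add: deriv_along_lie_bracket deriv_along_add[OF X] deriv_along_add[OF Y])
  have scale: "deriv_along ?B (a *\<^sub>R f) = a *\<^sub>R deriv_along ?B f" if "f \<in> ?S" for a f
    using that XY
    by (simp add: deriv_along_lie_bracket deriv_along_scaleR[OF X] deriv_along_scaleR[OF Y]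
        scaleR_diff_right)
  have mult: "deriv_along ?B (f * h) = f * deriv_along ?B h + h * deriv_along ?B f"
    if f: "f \<in> ?S" and h: "h \<in> ?S" for f h
  proof -
    have second: "deriv_along U (deriv_along U' (f * h))
        = (f * deriv_along U (deriv_along U' h) + deriv_along U' h * deriv_along U f)
        + (h * deriv_along U (deriv_along U' f) + deriv_along U' f * deriv_along U h)"
      if U: "U \<in> vector_fields M" and U': "U' \<in> vector_fields M" for U U'
      using deriv_along_smooth[OF U' f] deriv_along_smooth[OF U' h]
      by (simp add: deriv_along_mult[OF U' f h] deriv_along_add[OF U] deriv_along_mult[OF U] f h
          smooth_functions_mult[OF M])
    show ?thesis
      unfolding deriv_along_lie_bracket second[OF X Y] second[OF Y X]
      by (simp add: fun_eq_iff right_diff_distrib)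
  qed
  have zero: "deriv_along ?B f = 0" if "f \<notin> ?S" for f
  proof -
    have "deriv_along A (0 :: 'a \<Rightarrow> real) = 0" if "A \<in> vector_fields M" for A
      using deriv_along_scaleR[OF that smooth_functions_const, of 0] by simp
    then show ?thesis
      using that X Y by (simp add: deriv_along_lie_bracket deriv_along_not_smooth)
  qed
  have "?B p \<in> tangent_space M p" for p
    using fun_cong[OF add, of _ _ p] fun_cong[OF scale, of _ _ p] fun_cong[OF mult, of _ _ p]
      fun_cong[OF zero, of _ p]
    by (simp add: tangent_space_def deriv_along_def scaleR_apply)
  moreover have "?B p = 0" if "p \<notin> pts M" for p
    using X Y that by (simp add: vector_fields_def lie_bracket_def fun_eq_iff)
  moreover have "deriv_along ?B f \<in> ?S" if "f \<in> ?S" for f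
    using that XY subspace_diff[OF subspace_smooth_functions[OF M]]
    by (simp add: deriv_along_lie_bracket)
  ultimately show ?thesis
    by (simp add: vector_fields_def)
qed

lemma linear_connection_closed:
  "\<lbrakk>linear_connection M D; X \<in> vector_fields M; Y \<in> vector_fields M\<rbrakk> \<Longrightarrow> D X Y \<in> vector_fields M"
  unfolding linear_connection_def by blast

lemma curvature_in_vector_fields:
  assumes M: "smooth_manifold M" and D: "linear_connection M D"
    and "X \<in> vector_fields M" "Y \<in> vector_fields M" "Z \<in> vector_fields M"
  shows "curvature D X Y Z \<in> vector_fields M"
  unfolding curvature_def
  by (intro subspace_diff[OF subspace_vector_fields[OF M]] linear_connection_closed[OF D]
      lie_bracket_in_vector_fields[OF M] assms)

section \<open>Metric and almost complex structure on vector fields\<close>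

lemma linear_between_diff:
  assumes "linear_between V U L" "subspace V" "v \<in> V" "w \<in> V"
  shows "L (v - w) = L v - L w"
proof -
  have "L (v + (-1) *\<^sub>R w) = L v + (-1) *\<^sub>R L w"
    using assms subspace_scale[of V w "-1"] unfolding linear_between_def by metis
  then show ?thesis by simp
qed

lemma
  assumes g: "pseudo_riemannian_metric M r s g"
    and A: "A \<in> vector_fields M" and B: "B \<in> vector_fields M"
  shows on_fields_commute: "on_fields M g A B = on_fields M g B A"
    and on_fields_diff_right: "C \<in> vector_fields M \<Longrightarrow>
          on_fields M g A (B - C) = on_fields M g A B - on_fields M g A C"
proof -
  show "on_fields M g A B = on_fields M g B A"
    using assms
    by (auto simp: on_fields_def pseudo_riemannian_metric_def symmetric_bilinear_on_def
        vector_fields_def)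
  show "on_fields M g A (B - C) = on_fields M g A B - on_fields M g A C" if "C \<in> vector_fields M"
  proof
    fix p
    show "on_fields M g A (B - C) p = (on_fields M g A B - on_fields M g A C) p"
    proof (cases "p \<in> pts M")
      case True
      then have "linear_between (tangent_space M p) UNIV (g p (A p))"
        "B p \<in> tangent_space M p" "C p \<in> tangent_space M p"
        using g A B that
        by (auto simp: pseudo_riemannian_metric_def symmetric_bilinear_on_def vector_fields_def)
      then show ?thesis
        using True linear_between_diff[OF _ subspace_tangent_space] by (simp add: on_fields_def)
    qed (simp add: on_fields_def)
  qed
qed

lemma on_fields_diff_left:
  assumes "smooth_manifold M" "pseudo_riemannian_metric M r s g"
    and "A \<in> vector_fields M" "B \<in> vector_fields M" "C \<in> vector_fields M"
  shows "on_fields M g (A - B) C = on_fields M g A C - on_fields M g B C"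
  using on_fields_diff_right[OF assms(2,5,3,4)] on_fields_commute[OF assms(2)]
    subspace_diff[OF subspace_vector_fields[OF assms(1)]] assms(3-5) by metis

lemma on_fields_uminus_left:
  assumes "smooth_manifold M" "pseudo_riemannian_metric M r s g"
    and "A \<in> vector_fields M" "C \<in> vector_fields M"
  shows "on_fields M g (- A) C = - on_fields M g A C"
proof -
  have "on_fields M g 0 C = 0"
    using on_fields_diff_left[OF assms(1,2,3,3,4)] by simp
  then show ?thesis
    using on_fields_diff_left[OF assms(1,2) subspace_0[OF subspace_vector_fields[OF assms(1)]] assms(3,4)]
    by simp
qed

lemma endo_on_fields_diff:
  assumes J: "almost_complex_structure M J" and A: "A \<in> vector_fields M" and B: "B \<in> vector_fields M"
  shows "endo_on_fields M J (A - B) = endo_on_fields M J A - endo_on_fields M J B"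
proof
  fix p
  show "endo_on_fields M J (A - B) p = (endo_on_fields M J A - endo_on_fields M J B) p"
  proof (cases "p \<in> pts M")
    case True
    then have "linear_between (tangent_space M p) (tangent_space M p) (J p)"
      "A p \<in> tangent_space M p" "B p \<in> tangent_space M p"
      using assms by (auto simp: almost_complex_structure_def vector_fields_def)
    then show ?thesis
      using True linear_between_diff[OF _ subspace_tangent_space]
      by (simp add: endo_on_fields_def)
  qed (simp add: endo_on_fields_def)
qed

lemma endo_on_fields_square:
  assumes "almost_complex_structure M J" "A \<in> vector_fields M"
  shows "endo_on_fields M J (endo_on_fields M J A) = - A"
  using assms by (auto simp: endo_on_fields_def almost_complex_structure_def vector_fields_def fun_eq_iff)

text \<open>Because \<open>J\<^sup>2 = -1\<close>, each \<open>J\<^sub>p\<close> is injective on the tangent space and \<open>-J\<^sub>p v\<close> is the preimage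
  of \<open>v\<close>. So the choice made by the pointwise inverse is forced.\<close>

lemma endo_on_fields_tendo_inv:
  assumes J: "almost_complex_structure M J" and A: "A \<in> vector_fields M"
  shows "endo_on_fields M (tendo_inv M J) A = - endo_on_fields M J A"
proof
  fix p
  show "endo_on_fields M (tendo_inv M J) A p = (- endo_on_fields M J A) p"
  proof (cases "p \<in> pts M")
    case True
    let ?T = "tangent_space M p"
    have lin: "linear_between ?T ?T (J p)" and sq: "\<And>v. v \<in> ?T \<Longrightarrow> J p (J p v) = - v"
      and Ap: "A p \<in> ?T"
      using True J A by (auto simp: almost_complex_structure_def vector_fields_def)
    have inj: "inj_on (J p) ?T"
      by (rule inj_onI) (metis sq neg_equal_iff_equal)
    have JA: "J p (A p) \<in> ?T"
      using lin Ap by (auto simp: linear_between_def)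
    have zero: "J p 0 = 0"
      using linear_between_diff[OF lin subspace_tangent_space Ap Ap] by simp
    have "J p (- J p (A p)) = A p"
      using linear_between_diff[OF lin subspace_tangent_space subspace_0[OF subspace_tangent_space] JA]
        sq[OF Ap] zero by simp
    then have "inv_into ?T (J p) (A p) = - J p (A p)"
      using inv_into_f_f[OF inj subspace_neg[OF subspace_tangent_space JA]] by simp
    then show ?thesis
      using True by (simp add: endo_on_fields_def tendo_inv_def)
  qed (simp add: endo_on_fields_def)
qed

section \<open>Curvature of conjugate connections\<close>

text \<open>The two curvatures arise together when the commutator of \<open>X\<close> and \<open>Y\<close> is applied to the
  function \<open>g(A,B)\<close>: the curvature operators act as a derivation on the pairing, and on functions
  \<open>[X,Y]\<close> is by definition that commutator, so functions carry no curvature.\<close>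

lemma curvature_g_conjugate:
  assumes M: "smooth_manifold M" and g: "pseudo_riemannian_metric M r s g"
    and D: "linear_connection M D" and conj: "is_g_conjugate M g D Dstar"
    and X: "X \<in> vector_fields M" and Y: "Y \<in> vector_fields M"
    and A: "A \<in> vector_fields M" and B: "B \<in> vector_fields M"
  shows "curvature4 M g D X Y A B = - curvature4 M g Dstar X Y B A"
proof -
  let ?g = "on_fields M g" and ?V = "vector_fields M" and ?L = "lie_bracket X Y"
  have Dv: "D U C \<in> ?V" and Dsv: "Dstar U C \<in> ?V" if "U \<in> ?V" "C \<in> ?V" for U C
    using D conj that linear_connection_closed unfolding is_g_conjugate_def by blast+
  have gs: "?g C E \<in> smooth_functions M" if "C \<in> ?V" "E \<in> ?V" for C E
    using g that by (simp add: pseudo_riemannian_metric_def)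
  have rule1: "deriv_along U (?g C E) = ?g (D U C) E + ?g C (Dstar U E)"
    if "U \<in> ?V" "C \<in> ?V" "E \<in> ?V" for U C E
    using conj that by (simp add: is_g_conjugate_def)
  have L: "?L \<in> ?V"
    by (rule lie_bracket_in_vector_fields[OF M X Y])
  \<comment> \<open>The second and third summand change places when \<open>U\<close> and \<open>U'\<close> are swapped, so they cancel in the
    commutator.\<close>
  have rule2: "deriv_along U (deriv_along U' (?g A B)) =
      (?g (D U (D U' A)) B + ?g (D U' A) (Dstar U B)) + (?g (D U A) (Dstar U' B) + ?g A (Dstar U (Dstar U' B)))"
    if "U \<in> ?V" "U' \<in> ?V" for U U'
    using that A B Dv Dsv gs deriv_along_add[OF that(1)] by (simp add: rule1)
  have R: "?g (curvature D X Y A) B = ?g (D X (D Y A)) B - ?g (D Y (D X A)) B - ?g (D ?L A) B"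
    unfolding curvature_def
    using X Y A B L Dv subspace_diff[OF subspace_vector_fields[OF M]]
    by (simp add: on_fields_diff_left[OF M g])
  have Rstar: "?g A (curvature Dstar X Y B)
      = ?g A (Dstar X (Dstar Y B)) - ?g A (Dstar Y (Dstar X B)) - ?g A (Dstar ?L B)"
    unfolding curvature_def
    using X Y A B L Dsv subspace_diff[OF subspace_vector_fields[OF M]]
    by (simp add: on_fields_diff_right[OF g])
  have bracket: "deriv_along ?L (?g A B)
      = deriv_along X (deriv_along Y (?g A B)) - deriv_along Y (deriv_along X (?g A B))"
    by (rule deriv_along_lie_bracket)
  have "?g (curvature D X Y A) B = - ?g A (curvature Dstar X Y B)"
  proof
    show "?g (curvature D X Y A) B p = (- ?g A (curvature Dstar X Y B)) p" for p
      using fun_cong[OF bracket[unfolded rule1[OF L A B] rule2[OF X Y] rule2[OF Y X]], of p]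
      by (simp add: R Rstar)
  qed
  moreover have "curvature Dstar X Y B \<in> ?V"
    using conj curvature_in_vector_fields[OF M _ X Y B] by (simp add: is_g_conjugate_def)
  ultimately show ?thesis
    by (simp add: curvature4_def on_fields_commute[OF g A])
qed

text \<open>In \<open>\<nabla>\<^sup>J\<^sub>X \<nabla>\<^sup>J\<^sub>Y Z\<close> the inner factors \<open>J J\<^sup>-\<^sup>1\<close> cancel, so every term of the curvature is
  conjugated by \<open>J\<close>; the inverse is written as \<open>-J\<close>.\<close>

lemma curvature_J_conjugate:
  assumes M: "smooth_manifold M" and J: "almost_complex_structure M J"
    and D: "linear_connection M D"
    and X: "X \<in> vector_fields M" and Y: "Y \<in> vector_fields M" and Z: "Z \<in> vector_fields M"
  shows "curvature (J_conjugate M J D) X Y Z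
           = - endo_on_fields M J (curvature D X Y (endo_on_fields M J Z))"
proof -
  let ?J = "endo_on_fields M J" and ?V = "vector_fields M"
  have Jv: "?J A \<in> ?V" if "A \<in> ?V" for A
    using J that by (simp add: almost_complex_structure_def)
  have Dv: "D U A \<in> ?V" if "U \<in> ?V" "A \<in> ?V" for U A
    by (rule linear_connection_closed[OF D that])
  note sub = subspace_vector_fields[OF M]
  have DJ: "J_conjugate M J D U A = - ?J (D U (?J A))" if "U \<in> ?V" "A \<in> ?V" for U A
    using that by (simp add: J_conjugate_def endo_on_fields_tendo_inv[OF J] Jv Dv)
  have J0: "?J 0 = 0"
    using endo_on_fields_diff[OF J Z Z] by simp
  have JJinv: "?J (- ?J A) = A" if "A \<in> ?V" for A
    using endo_on_fields_diff[OF J subspace_0[OF sub] Jv[OF that]]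
    by (simp add: J0 endo_on_fields_square[OF J that])
  have DJDJ: "J_conjugate M J D U (J_conjugate M J D U' Z) = - ?J (D U (D U' (?J Z)))"
    if "U \<in> ?V" "U' \<in> ?V" for U U'
    using that Z by (simp add: DJ JJinv Jv Dv subspace_neg[OF sub])
  show ?thesis
    unfolding curvature_def DJDJ[OF X Y] DJDJ[OF Y X]
      DJ[OF lie_bracket_in_vector_fields[OF M X Y] Z]
    using X Y Z lie_bracket_in_vector_fields[OF M X Y]
    by (simp add: endo_on_fields_diff[OF J] Jv Dv subspace_diff[OF sub])
qed

theorem theorem2:
  fixes M :: "('a, 'e::euclidean_space) mfd"
    and n :: nat
    and J :: "'a tendo"
    and g G :: "'a tform"
    and D Dstar :: "'a connection"
    and X Y Z W :: "'a vfield"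
  assumes "almost_anti_hermitian n M J g G"
    and "linear_connection M D"
    and "is_g_conjugate M g D Dstar"
    and "X \<in> vector_fields M" "Y \<in> vector_fields M"
    and "Z \<in> vector_fields M" "W \<in> vector_fields M"
  shows "curvature4 M g D X Y (endo_on_fields M J Z) W
           = - curvature4 M g Dstar X Y W (endo_on_fields M J Z)
         \<and> - curvature4 M g Dstar X Y W (endo_on_fields M J Z)
           = curvature4 M g (J_conjugate M J D) X Y Z (endo_on_fields M J W)"
proof -
  have M: "smooth_manifold M" and J: "almost_complex_structure M J"
    and g: "pseudo_riemannian_metric M n n g"
    and anti: "\<And>A B. \<lbrakk>A \<in> vector_fields M; B \<in> vector_fields M\<rbrakk> \<Longrightarrow>
      on_fields M g (endo_on_fields M J A) (endo_on_fields M J B) = - on_fields M g A B"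
    using assms(1) by (auto simp: almost_anti_hermitian_def)
  have Jv: "endo_on_fields M J A \<in> vector_fields M" if "A \<in> vector_fields M" for A
    using J that by (simp add: almost_complex_structure_def)
  let ?R = "curvature D X Y (endo_on_fields M J Z)"
  have R: "?R \<in> vector_fields M"
    using curvature_in_vector_fields[OF M assms(2,4,5)] Jv assms(6) by simp
  have "curvature4 M g (J_conjugate M J D) X Y Z (endo_on_fields M J W)
      = on_fields M g (- endo_on_fields M J ?R) (endo_on_fields M J W)"
    using curvature_J_conjugate[OF M J assms(2,4,5,6)] by (simp add: curvature4_def)
  also have "\<dots> = curvature4 M g D X Y (endo_on_fields M J Z) W"
    using on_fields_uminus_left[OF M g Jv[OF R] Jv] anti[OF R] assms(7)
    by (simp add: curvature4_def)
  finally show ?thesis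
    using curvature_g_conjugate[OF M g assms(2,3,4,5) Jv assms(7)] assms(6) by simp
qed

end
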